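(* Let $(\mathcal{A},\cdot)$ and $(\mathcal{A}^*,\circ)$ be two center-symmetric algebras, where $\mathcal{A}^*$ is the dual space of $\mathcal{A}$. Then $(\mathcal{A},\mathcal{A}^*,R^*_{\cdot},L^*_{\cdot},R^*_{\circ},L^*_{\circ})$ is a matched pair of the center-symmetric algebras $\mathcal{A}$ and $\mathcal{A}^*$ if and only if $(\mathcal{A}\oplus\mathcal{A}^*,\mathcal{A},\mathcal{A}^* )$ is their standard Manin triple.
   Context: Throughout, $\mathcal{A}$ is a finite-dimensional vector space over a field $\mathbb{K}$ of characteristic zero. A vector space with a bilinear product is a center-symmetric algebra if its associator $(x,y,z):=(xy)z-x(yz)$ satisfies $(x,y,z)=(z,y,x)$ for all $x,y,z$. Notation: $L_{\cdot}(x)y=x\cdot y$, $R_{\cdot}(x)y=y\cdot x$; likewise $L_{\circ},R_{\circ}$ for $(\mathcal{A}^*,\circ)$. For a linear map $l:\mathcal{A}\to\mathfrak{gl}(V)$ the dual map $l^*:\mathcal{A}\to\mathfrak{gl}(V^* )$ is the transpose without sign: $\langle l^*_xu^*,v\rangle=\langle u^*,l_xv\rangle$. Thus $R^*_{\cdot},L^*_{\cdot}:\mathcal{A}\to\mathfrak{gl}(\mathcal{A}^* )$ and $R^*_{\circ},L^*_{\circ}:\mathcal{A}^*\to\mathfrak{gl}(\mathcal{A})$ (identifying $\mathcal{A}^{**}=\mathcal{A}$). Bimodule: for linear maps $l,r:\mathcal{A}\to\mathfrak{gl}(V)$, $(l,r,V)$ is a bimodule of $\mathcal{A}$ if for all $x,y\in\mathcal{A}$: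 $[l_x,r_y]=[l_y,r_x]$ and $l_{xy}-l_xl_y=r_xr_y-r_{yx}$. Matched pair of center-symmetric algebras: given center-symmetric algebras $(\mathcal{A},\cdot)$, $(\mathcal{B},\circ)$, a bimodule $(l_{\mathcal{A}},r_{\mathcal{A}},\mathcal{B})$ of $\mathcal{A}$ and a bimodule $(l_{\mathcal{B}},r_{\mathcal{B}},\mathcal{A})$ of $\mathcal{B}$, the tuple $(\mathcal{A},\mathcal{B},l_{\mathcal{A}},r_{\mathcal{A}},l_{\mathcal{B}},r_{\mathcal{B}})$ is a matched pair of center-symmetric algebras if for all $x,y\in\mathcal{A}$, $a,b\in\mathcal{B}$: $$-r_{\mathcal{A}}(x)(a\circ b)+r_{\mathcal{A}}(l_{\mathcal{B}}(b)x)a+a\circ(r_{\mathcal{A}}(x)b)+l_{\mathcal{A}}(r_{\mathcal{B}}(b)x)a+(l_{\mathcal{A}}(x)b)\circ a-l_{\mathcal{A}}(x)(b\circ a)=0,$$ $$-r_{\mathcal{B}}(a)(x\cdot y)+r_{\mathcal{B}}(l_{\mathcal{A}}(y)a)x+x\cdot(r_{\mathcal{B}}(a)y)+l_{\mathcal{B}}(r_{\mathcal{A}}(y)a)x+(l_{\mathcal{B}}(a)y)\cdot x-l_{\mathcal{B}}(a)(y\cdot x)=0,$$ $$a\circ(l_{\mathcal{A}}(x)b)+(r_{\mathcal{A}}(x)b)\circ a-(r_{\mathcal{A}}(x)a)\circ b-l_{\mathcal{A}}(l_{\mathcal{B}}(a)x)b+r_{\mathcal{A}}(r_{\mathcal{B}}(b)x)a+l_{\mathcal{A}}(l_{\mathcal{B}}(b)x)a-b\circ(l_{\mathcal{A}}(x)a)-r_{\mathcal{A}}(r_{\mathcal{B}}(a)x)b=0,$$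 $$x\cdot(l_{\mathcal{B}}(a)y)+(r_{\mathcal{B}}(a)y)\cdot x-(r_{\mathcal{B}}(a)x)\cdot y-l_{\mathcal{B}}(l_{\mathcal{A}}(x)a)y+r_{\mathcal{B}}(r_{\mathcal{A}}(y)a)x+l_{\mathcal{B}}(l_{\mathcal{A}}(y)a)x-y\cdot(l_{\mathcal{B}}(a)x)-r_{\mathcal{B}}(r_{\mathcal{A}}(x)a)y=0.$$ Here $\mathcal{B}=\mathcal{A}^*$, $l_{\mathcal{A}}=R^*_{\cdot}$, $r_{\mathcal{A}}=L^*_{\cdot}$, $l_{\mathcal{B}}=R^*_{\circ}$, $r_{\mathcal{B}}=L^*_{\circ}$. Manin triple: a Manin triple of center-symmetric algebras is a triple $(\mathcal{C},\mathcal{C}^+,\mathcal{C}^-)$, with $\mathcal{C}$ a center-symmetric algebra with product $\ast$, together with a nondegenerate symmetric bilinear form $\mathfrak{B}$ on $\mathcal{C}$ that is invariant, i.e. $\mathfrak{B}(x\ast y,z)=\mathfrak{B}(x,y\ast z)$ for all $x,y,z\in\mathcal{C}$, such that $\mathcal{C}=\mathcal{C}^+\oplus\mathcal{C}^-$ as vector spaces, $\mathcal{C}^\pm$ are center-symmetric subalgebras of $\mathcal{C}$, and $\mathfrak{B}(\mathcal{C}^+,\mathcal{C}^+)=0=\mathfrak{B}(\mathcal{C}^-,\mathcal{C}^-)$. Standard Manin triple: $(\mathcal{A}\oplus\mathcal{A}^*,\mathcal{A},\mathcal{A}^* )$ is the standard Manin triple of $(\mathcal{A},\cdot)$ and $(\mathcal{A}^*,\circ)$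 if there is a center-symmetric algebra structure on $\mathcal{A}\oplus\mathcal{A}^*$, containing $(\mathcal{A},\cdot)$ and $(\mathcal{A}^*,\circ)$ as subalgebras, for which $(\mathcal{A}\oplus\mathcal{A}^*,\mathcal{A},\mathcal{A}^* )$ is a Manin triple with respect to the form $\mathfrak{B}_{\mathcal{A}}(x+a^*,y+b^* )=\langle x,b^*\rangle+\langle y,a^*\rangle$, $x,y\in\mathcal{A}$, $a^*,b^*\in\mathcal{A}^*$. *)

theory Defs
  imports "HOL-Analysis.Product_Vector" "HOL-Library.Function_Algebras"
begin

text \<open>
  Algebras live on a carrier, a subspace of an ambient vector space, because the dual space is a
  subspace of the type of all functions into the scalars (with the pointwise operations of
  \<^theory>\<open>HOL-Library.Function_Algebras\<close>). Operations are total functions of which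
  only the values on carriers matter.
\<close>

definition linear_between ::
  "('k \<Rightarrow> 'v \<Rightarrow> 'v) \<Rightarrow> 'v set \<Rightarrow> ('k \<Rightarrow> 'w \<Rightarrow> 'w) \<Rightarrow> 'w set \<Rightarrow> ('v::plus \<Rightarrow> 'w::plus) \<Rightarrow> bool"
  where "linear_between s V t W f \<longleftrightarrow>
    (\<forall>x\<in>V. f x \<in> W) \<and>
    (\<forall>x\<in>V. \<forall>y\<in>V. f (x + y) = f x + f y) \<and>
    (\<forall>c. \<forall>x\<in>V. f (s c x) = t c (f x))"

definition bilinear_between ::
  "('k \<Rightarrow> 'u \<Rightarrow> 'u) \<Rightarrow> 'u set \<Rightarrow> ('k \<Rightarrow> 'v \<Rightarrow> 'v) \<Rightarrow> 'v set \<Rightarrow> ('k \<Rightarrow> 'w \<Rightarrow> 'w) \<Rightarrow> 'w set \<Rightarrow>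
    ('u::plus \<Rightarrow> 'v::plus \<Rightarrow> 'w::plus) \<Rightarrow> bool"
  where "bilinear_between r U s V t W f \<longleftrightarrow>
    (\<forall>x\<in>U. linear_between s V t W (f x)) \<and>
    (\<forall>y\<in>V. linear_between r U t W (\<lambda>x. f x y))"

definition assoc :: "('v \<Rightarrow> 'v \<Rightarrow> 'v) \<Rightarrow> 'v \<Rightarrow> 'v \<Rightarrow> 'v \<Rightarrow> 'v::minus"
  where "assoc m x y z = m (m x y) z - m x (m y z)"

definition center_symmetric_algebra ::
  "('k::field \<Rightarrow> 'v::ab_group_add \<Rightarrow> 'v) \<Rightarrow> 'v set \<Rightarrow> ('v \<Rightarrow> 'v \<Rightarrow> 'v) \<Rightarrow> bool"
  where "center_symmetric_algebra s A m \<longleftrightarrow>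
    vector_space s \<and> module.subspace s A \<and> bilinear_between s A s A s A m \<and>
    (\<forall>x\<in>A. \<forall>y\<in>A. \<forall>z\<in>A. assoc m x y z = assoc m z y x)"

definition Lmult :: "('v \<Rightarrow> 'v \<Rightarrow> 'v) \<Rightarrow> 'v \<Rightarrow> 'v \<Rightarrow> 'v"
  where "Lmult m x y = m x y"

definition Rmult :: "('v \<Rightarrow> 'v \<Rightarrow> 'v) \<Rightarrow> 'v \<Rightarrow> 'v \<Rightarrow> 'v"
  where "Rmult m x y = m y x"

text \<open>
  In the next definition bilinearity of the curried action says exactly that it is a linear map
  from the algebra into the linear endomorphisms of \<open>V\<close>.
\<close>

definition bimodule ::
  "('k::field \<Rightarrow> 'v::ab_group_add \<Rightarrow> 'v) \<Rightarrow> 'v set \<Rightarrow> ('v \<Rightarrow> 'v \<Rightarrow> 'v) \<Rightarrow>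
   ('k \<Rightarrow> 'w::ab_group_add \<Rightarrow> 'w) \<Rightarrow> 'w set \<Rightarrow> ('v \<Rightarrow> 'w \<Rightarrow> 'w) \<Rightarrow> ('v \<Rightarrow> 'w \<Rightarrow> 'w) \<Rightarrow> bool"
  where "bimodule s A m t V l r \<longleftrightarrow>
    vector_space t \<and> module.subspace t V \<and>
    bilinear_between s A t V t V l \<and> bilinear_between s A t V t V r \<and>
    (\<forall>x\<in>A. \<forall>y\<in>A. \<forall>v\<in>V. l x (r y v) - r y (l x v) = l y (r x v) - r x (l y v)) \<and>
    (\<forall>x\<in>A. \<forall>y\<in>A. \<forall>v\<in>V. l (m x y) v - l x (l y v) = r x (r y v) - r (m y x) v)"

definition matched_pair ::
  "('k::field \<Rightarrow> 'v::ab_group_add \<Rightarrow> 'v) \<Rightarrow> 'v set \<Rightarrow> ('v \<Rightarrow> 'v \<Rightarrow> 'v) \<Rightarrow>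
   ('k \<Rightarrow> 'w::ab_group_add \<Rightarrow> 'w) \<Rightarrow> 'w set \<Rightarrow> ('w \<Rightarrow> 'w \<Rightarrow> 'w) \<Rightarrow>
   ('v \<Rightarrow> 'w \<Rightarrow> 'w) \<Rightarrow> ('v \<Rightarrow> 'w \<Rightarrow> 'w) \<Rightarrow> ('w \<Rightarrow> 'v \<Rightarrow> 'v) \<Rightarrow> ('w \<Rightarrow> 'v \<Rightarrow> 'v) \<Rightarrow> bool"
  where "matched_pair s A m t B n lA rA lB rB \<longleftrightarrow>
    center_symmetric_algebra s A m \<and> center_symmetric_algebra t B n \<and>
    bimodule s A m t B lA rA \<and> bimodule t B n s A lB rB \<and>
    (\<forall>x\<in>A. \<forall>a\<in>B. \<forall>b\<in>B.
      - rA x (n a b) + rA (lB b x) a + n a (rA x b)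
      + lA (rB b x) a + n (lA x b) a - lA x (n b a) = 0) \<and>
    (\<forall>x\<in>A. \<forall>y\<in>A. \<forall>a\<in>B.
      - rB a (m x y) + rB (lA y a) x + m x (rB a y)
      + lB (rA y a) x + m (lB a y) x - lB a (m y x) = 0) \<and>
    (\<forall>x\<in>A. \<forall>a\<in>B. \<forall>b\<in>B.
      n a (lA x b) + n (rA x b) a - n (rA x a) b - lA (lB a x) b
      + rA (rB b x) a + lA (lB b x) a - n b (lA x a) - rA (rB a x) b = 0) \<and>
    (\<forall>x\<in>A. \<forall>y\<in>A. \<forall>a\<in>B.
      m x (lB a y) + m (rB a y) x - m (rB a x) y - lB (lA x a) y
      + rB (rA y a) x + lB (lA y a) x - m y (lB a x) - rB (rA x a) y = 0)"

definition subalgebra ::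
  "('k::field \<Rightarrow> 'v::ab_group_add \<Rightarrow> 'v) \<Rightarrow> 'v set \<Rightarrow> ('v \<Rightarrow> 'v \<Rightarrow> 'v) \<Rightarrow> 'v set \<Rightarrow> bool"
  where "subalgebra s C m S \<longleftrightarrow>
    S \<subseteq> C \<and> module.subspace s S \<and> (\<forall>x\<in>S. \<forall>y\<in>S. m x y \<in> S)"

definition direct_sum :: "'v::ab_group_add set \<Rightarrow> 'v set \<Rightarrow> 'v set \<Rightarrow> bool"
  where "direct_sum C P Q \<longleftrightarrow> C = {p + q | p q. p \<in> P \<and> q \<in> Q} \<and> P \<inter> Q = {0}"

definition manin_triple ::
  "('k::field \<Rightarrow> 'v::ab_group_add \<Rightarrow> 'v) \<Rightarrow> 'v set \<Rightarrow> 'v set \<Rightarrow> 'v set \<Rightarrow>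
   ('v \<Rightarrow> 'v \<Rightarrow> 'v) \<Rightarrow> ('v \<Rightarrow> 'v \<Rightarrow> 'k) \<Rightarrow> bool"
  where "manin_triple s C P Q m \<B> \<longleftrightarrow>
    center_symmetric_algebra s C m \<and>
    bilinear_between s C s C (*) UNIV \<B> \<and>
    (\<forall>x\<in>C. \<forall>y\<in>C. \<B> x y = \<B> y x) \<and>
    (\<forall>x\<in>C. (\<forall>y\<in>C. \<B> x y = 0) \<longrightarrow> x = 0) \<and>
    (\<forall>x\<in>C. \<forall>y\<in>C. \<forall>z\<in>C. \<B> (m x y) z = \<B> x (m y z)) \<and>
    direct_sum C P Q \<and>
    subalgebra s C m P \<and> subalgebra s C m Q \<and>
    (\<forall>x\<in>P. \<forall>y\<in>P. \<B> x y = 0) \<and> (\<forall>x\<in>Q. \<forall>y\<in>Q. \<B> x y = 0)"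

definition dual :: "('k::field \<Rightarrow> 'a::ab_group_add \<Rightarrow> 'a) \<Rightarrow> ('a \<Rightarrow> 'k) set"
  where "dual s = {f. Vector_Spaces.linear s (*) f}"

definition dual_scale :: "'k::times \<Rightarrow> ('a \<Rightarrow> 'k) \<Rightarrow> 'a \<Rightarrow> 'k"
  where "dual_scale c f = (\<lambda>v. c * f v)"

definition dual_map :: "('a \<Rightarrow> 'a) \<Rightarrow> ('a \<Rightarrow> 'k) \<Rightarrow> 'a \<Rightarrow> 'k"
  where "dual_map f u = (\<lambda>v. u (f v))"

text \<open>
  The transpose of an endomorphism \<open>g\<close> of the dual space, as an endomorphism of the original
  space: the element \<open>y\<close> representing, under evaluation, the functional
  \<open>b \<mapsto> \<langle>x, g b\<rangle>\<close> of the bidual. It exists and is unique in finite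
  dimension, see \<open>bidual_dual_map_ex1\<close> below.
\<close>

definition bidual_dual_map ::
  "('k::field \<Rightarrow> 'a::ab_group_add \<Rightarrow> 'a) \<Rightarrow> (('a \<Rightarrow> 'k) \<Rightarrow> 'a \<Rightarrow> 'k) \<Rightarrow> 'a \<Rightarrow> 'a"
  where "bidual_dual_map s g x = (THE y. \<forall>b\<in>dual s. b y = g b x)"

definition standard_form :: "'a \<times> ('a \<Rightarrow> 'k::plus) \<Rightarrow> 'a \<times> ('a \<Rightarrow> 'k) \<Rightarrow> 'k"
  where "standard_form p q = snd q (fst p) + snd p (fst q)"

definition standard_manin_triple ::
  "('k::field \<Rightarrow> 'a::ab_group_add \<Rightarrow> 'a) \<Rightarrow> ('a \<Rightarrow> 'a \<Rightarrow> 'a) \<Rightarrow>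
   (('a \<Rightarrow> 'k) \<Rightarrow> ('a \<Rightarrow> 'k) \<Rightarrow> 'a \<Rightarrow> 'k) \<Rightarrow> bool"
  where "standard_manin_triple s m n \<longleftrightarrow>
    (\<exists>p. (\<forall>x y. p (x, 0) (y, 0) = (m x y, 0)) \<and>
         (\<forall>a\<in>dual s. \<forall>b\<in>dual s. p (0, a) (0, b) = (0, n a b)) \<and>
         manin_triple (module_prod.scale s dual_scale)
           (UNIV \<times> dual s) (UNIV \<times> {0}) ({0} \<times> dual s) p standard_form)"

lemma vector_space_dual_scale: "vector_space (dual_scale :: 'k::field \<Rightarrow> ('a \<Rightarrow> 'k) \<Rightarrow> _)"
  by unfold_locales (auto simp: dual_scale_def fun_eq_iff algebra_simps)

lemma in_dual_iff:
  assumes "vector_space s"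
  shows "f \<in> dual s \<longleftrightarrow> (\<forall>x y. f (x + y) = f x + f y) \<and> (\<forall>c x. f (s c x) = c * f x)"
proof -
  have "vector_space ((*) :: 'a \<Rightarrow> 'a \<Rightarrow> 'a)"
    by unfold_locales (auto simp: algebra_simps)
  then show ?thesis
    using assms by (auto simp: dual_def Vector_Spaces.linear_iff)
qed

lemma subspace_dual:
  assumes "vector_space s"
  shows "module.subspace dual_scale (dual s)"
proof -
  interpret d: vector_space "dual_scale :: 'a \<Rightarrow> ('b \<Rightarrow> 'a) \<Rightarrow> _"
    by (rule vector_space_dual_scale)
  show ?thesis
    unfolding d.subspace_def
    by (auto simp: in_dual_iff[OF assms] dual_scale_def algebra_simps)
qed

lemma bidual_dual_map_ex1:
  assumes "finite_dimensional_vector_space s Basis"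
    and g: "linear_between dual_scale (dual s) dual_scale (dual s) g"
  shows "\<exists>!y. \<forall>b\<in>dual s. b y = g b x"
proof -
  interpret finite_dimensional_vector_space s Basis by fact
  have vs: "vector_space s" by unfold_locales
  note dual_iff = in_dual_iff[OF vs]
  define c where "c e v = representation Basis v e" for e v
  have c: "c e \<in> dual s" for e
    using independent_Basis span_Basis
    by (auto simp: dual_iff c_def representation_add representation_scale)
  have expand: "(\<Sum>e\<in>Basis. s (c e v) e) = v" for v
    unfolding c_def using sum_representation_eq[OF independent_Basis, of v Basis] span_Basis finite_Basis
    by auto
  have sum: "f (\<Sum>e\<in>S. h e) = (\<Sum>e\<in>S. f (h e))" if "f \<in> dual s" "finite S" for f h and S :: "'b set"
    using that(2,1)
  proof (induction S)
    case empty
    have "f (0 + 0) = f 0 + f 0" using empty unfolding dual_iff by blast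
    then show ?case by (metis add_0 add_cancel_right_right sum.empty)
  qed (auto simp: dual_iff)
  have b_expand: "b v = (\<Sum>e\<in>Basis. c e v * b e)" if "b \<in> dual s" for b v
    using sum[OF that finite_Basis, of "\<lambda>e. s (c e v) e"] that expand[of v] by (simp add: dual_iff)
  interpret d: vector_space "dual_scale :: 'a \<Rightarrow> ('b \<Rightarrow> 'a) \<Rightarrow> _"
    by (rule vector_space_dual_scale)
  note sd = subspace_dual[OF vs]
  have gsum: "g (\<Sum>e\<in>S. dual_scale (k e) (c e)) = (\<Sum>e\<in>S. dual_scale (k e) (g (c e)))"
    if "finite S" for k and S :: "'b set"
    using that
  proof (induction S)
    case empty
    have "g (0 + 0) = g 0 + g 0"
      using g d.subspace_0[OF sd] unfolding linear_between_def by blast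
    then have "g 0 = 0" by (simp only: add_0 add_cancel_right_right)
    then show ?case by (simp only: sum.empty)
  next
    case (insert e S)
    have 1: "dual_scale (k e) (c e) \<in> dual s" "(\<Sum>e\<in>S. dual_scale (k e) (c e)) \<in> dual s"
      using c sd by (auto intro!: d.subspace_sum d.subspace_scale)
    have "g (dual_scale (k e) (c e) + (\<Sum>e\<in>S. dual_scale (k e) (c e)))
        = g (dual_scale (k e) (c e)) + g (\<Sum>e\<in>S. dual_scale (k e) (c e))"
      using g 1 unfolding linear_between_def by blast
    moreover have "g (dual_scale (k e) (c e)) = dual_scale (k e) (g (c e))"
      using g c unfolding linear_between_def by blast
    ultimately show ?case
      by (simp only: insert sum.insert not_False_eq_True)
  qed
  have app: "(\<Sum>e\<in>S. h e) x = (\<Sum>e\<in>S. h e x)" if "finite S" for h :: "'b \<Rightarrow> 'b \<Rightarrow> 'a" and S x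
    using that by (induction S) auto
  have b_eq: "b = (\<Sum>e\<in>Basis. dual_scale (b e) (c e))" if "b \<in> dual s" for b
  proof
    fix v
    show "b v = (\<Sum>e\<in>Basis. dual_scale (b e) (c e)) v"
      unfolding app[OF finite_Basis] dual_scale_def
      by (subst b_expand[OF that]) (simp add: mult.commute)
  qed
  define y where "y = (\<Sum>e\<in>Basis. s (g (c e) x) e)"
  have "b y = g b x" if "b \<in> dual s" for b
  proof -
    have "b y = (\<Sum>e\<in>Basis. g (c e) x * b e)"
      unfolding y_def using sum[OF that finite_Basis] that by (simp add: dual_iff)
    also have "\<dots> = (\<Sum>e\<in>Basis. dual_scale (b e) (g (c e))) x"
      unfolding app[OF finite_Basis] dual_scale_def by (simp only: mult.commute)
    also have "\<dots> = g b x"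
      unfolding gsum[OF finite_Basis, symmetric] b_eq[OF that, symmetric] ..
    finally show ?thesis .
  qed
  moreover have "y1 = y2" if "\<forall>b\<in>dual s. b y1 = g b x" "\<forall>b\<in>dual s. b y2 = g b x" for y1 y2
  proof -
    have "c e y1 = c e y2" for e using that c[of e] by metis
    then have "(\<Sum>e\<in>Basis. s (c e y1) e) = (\<Sum>e\<in>Basis. s (c e y2) e)" by (simp only:)
    then show ?thesis unfolding expand .
  qed
  ultimately show ?thesis by blast
qed

end

theory Submission
  imports Defs
begin

text \<open>
  On a direct sum of algebras \<open>A\<close> and \<open>B\<close> acting on each other, the associator is
  trilinear, so center-symmetry need only be tested on homogeneous triples; the components of these
  tests in \<open>A\<close> and \<open>B\<close> are exactly the bimodule and compatibility equations of a matched
  pair. For \<open>B = A\<^sup>*\<close> the transposed actions make the standard form invariant, and conversely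
  invariance determines the mixed products by pairing them with \<open>A\<close> and \<open>A\<^sup>*\<close>.
\<close>

section \<open>Bilinear maps and associators on a carrier\<close>

lemma linear_between_zero:
  fixes f :: "'v::ab_group_add \<Rightarrow> 'w::ab_group_add"
  assumes "linear_between s V t W f" "0 \<in> V"
  shows "f 0 = 0"
proof -
  have "f (0 + 0) = f 0 + f 0"
    using assms unfolding linear_between_def by blast
  then show ?thesis by simp
qed

lemma bilinear_betweenD:
  fixes f :: "'u::ab_group_add \<Rightarrow> 'v::ab_group_add \<Rightarrow> 'w::ab_group_add"
  assumes "bilinear_between r U s V t W f"
  shows "x \<in> U \<Longrightarrow> y \<in> V \<Longrightarrow> f x y \<in> W"
    and "x \<in> U \<Longrightarrow> x' \<in> U \<Longrightarrow> y \<in> V \<Longrightarrow> f (x + x') y = f x y + f x' y"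
    and "x \<in> U \<Longrightarrow> y \<in> V \<Longrightarrow> y' \<in> V \<Longrightarrow> f x (y + y') = f x y + f x y'"
    and "x \<in> U \<Longrightarrow> y \<in> V \<Longrightarrow> f (r c x) y = t c (f x y)"
    and "x \<in> U \<Longrightarrow> y \<in> V \<Longrightarrow> f x (s c y) = t c (f x y)"
    and "0 \<in> U \<Longrightarrow> y \<in> V \<Longrightarrow> f 0 y = 0"
    and "x \<in> U \<Longrightarrow> 0 \<in> V \<Longrightarrow> f x 0 = 0"
  using assms linear_between_zero[of s V t W "f x"] linear_between_zero[of r U t W "\<lambda>x. f x y"]
  unfolding bilinear_between_def linear_between_def by blast+

lemma bilinear_betweenI:
  assumes "\<And>x y. x \<in> U \<Longrightarrow> y \<in> V \<Longrightarrow> f x y \<in> W"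
    and "\<And>x x' y. x \<in> U \<Longrightarrow> x' \<in> U \<Longrightarrow> y \<in> V \<Longrightarrow> f (x + x') y = f x y + f x' y"
    and "\<And>x y y'. x \<in> U \<Longrightarrow> y \<in> V \<Longrightarrow> y' \<in> V \<Longrightarrow> f x (y + y') = f x y + f x y'"
    and "\<And>c x y. x \<in> U \<Longrightarrow> y \<in> V \<Longrightarrow> f (r c x) y = t c (f x y)"
    and "\<And>c x y. x \<in> U \<Longrightarrow> y \<in> V \<Longrightarrow> f x (s c y) = t c (f x y)"
  shows "bilinear_between r U s V t W f"
  using assms unfolding bilinear_between_def linear_between_def by blast

lemma assoc_add:
  fixes m :: "'v::ab_group_add \<Rightarrow> 'v \<Rightarrow> 'v"
  assumes "bilinear_between s C s C s C m"
    and C: "x \<in> C" "x' \<in> C" "y \<in> C" "z \<in> C"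
  shows "assoc m (x + x') y z = assoc m x y z + assoc m x' y z"
    and "assoc m y (x + x') z = assoc m y x z + assoc m y x' z"
    and "assoc m y z (x + x') = assoc m y z x + assoc m y z x'"
  by (simp_all add: assoc_def C bilinear_betweenD[OF assms(1)])

text \<open>Both sides are trilinear, so each expands into eight terms with entries in
  \<open>S\<close>, and reversal matches them term by term. \<open>S\<close> will be the union of
  two direct summands, which is not closed under addition; hence elements of \<open>C\<close> are
  only asked to be sums of two elements of \<open>S\<close>.\<close>

lemma assoc_symmetric_on_sum:
  fixes m :: "'v::ab_group_add \<Rightarrow> 'v \<Rightarrow> 'v"
  assumes bil: "bilinear_between s C s C s C m"
    and S: "S \<subseteq> C"
    and sym: "\<And>x y z. x \<in> S \<Longrightarrow> y \<in> S \<Longrightarrow> z \<in> S \<Longrightarrow> assoc m x y z = assoc m z y x"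
    and C: "\<And>x. x \<in> C \<Longrightarrow> \<exists>p\<in>S. \<exists>q\<in>S. x = p + q"
    and xyz: "x \<in> C" "y \<in> C" "z \<in> C"
  shows "assoc m x y z = assoc m z y x"
proof -
  obtain p q p' q' p'' q'' where
    eq: "x = p + q" "y = p' + q'" "z = p'' + q''"
    and in_S: "p \<in> S" "q \<in> S" "p' \<in> S" "q' \<in> S" "p'' \<in> S" "q'' \<in> S"
    using C xyz by metis
  have in_C: "p \<in> C" "q \<in> C" "p' \<in> C" "q' \<in> C" "p'' \<in> C" "q'' \<in> C"
    using in_S S by auto
  \<comment> \<open>\<open>assoc_add\<close> splits one slot at a time, so its side conditions also
    involve the sums still unsplit in the other slots.\<close>
  have add: "p + q \<in> C" "p' + q' \<in> C" "p'' + q'' \<in> C"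
    using eq xyz by auto
  have "assoc m (p + q) (p' + q') (p'' + q'') =
      assoc m p p' p'' + assoc m p p' q'' + assoc m p q' p'' + assoc m p q' q'' +
      assoc m q p' p'' + assoc m q p' q'' + assoc m q q' p'' + assoc m q q' q''"
    by (simp add: assoc_add[OF bil] in_C add)
  moreover have "assoc m (p'' + q'') (p' + q') (p + q) =
      assoc m p'' p' p + assoc m q'' p' p + assoc m p'' q' p + assoc m q'' q' p +
      assoc m p'' p' q + assoc m q'' p' q + assoc m p'' q' q + assoc m q'' q' q"
    by (simp add: assoc_add[OF bil] in_C add)
  ultimately show ?thesis
    unfolding eq using sym in_S by simp
qed

section \<open>The product attached to a pair of mutual actions\<close>

text \<open>Each \<open>l\<close> plays the part of left multiplication and each \<open>r\<close>
  that of right multiplication: \<open>(x, 0)\<close> times \<open>(0, b)\<close> is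
  \<open>(rB b x, lA x b)\<close>, and \<open>(0, a)\<close> times \<open>(y, 0)\<close> is
  \<open>(lB a y, rA y a)\<close>.\<close>

definition bicrossed_product ::
  "('v \<Rightarrow> 'v \<Rightarrow> 'v) \<Rightarrow> ('w \<Rightarrow> 'w \<Rightarrow> 'w) \<Rightarrow>
   ('v \<Rightarrow> 'w \<Rightarrow> 'w) \<Rightarrow> ('v \<Rightarrow> 'w \<Rightarrow> 'w) \<Rightarrow> ('w \<Rightarrow> 'v \<Rightarrow> 'v) \<Rightarrow> ('w \<Rightarrow> 'v \<Rightarrow> 'v) \<Rightarrow>
   'v \<times> 'w \<Rightarrow> 'v \<times> 'w \<Rightarrow> ('v::plus) \<times> ('w::plus)"
  where "bicrossed_product m n lA rA lB rB p q =
    (m (fst p) (fst q) + lB (snd p) (fst q) + rB (snd q) (fst p),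
     n (snd p) (snd q) + lA (fst p) (snd q) + rA (fst q) (snd p))"

text \<open>The actions are assumed bilinear only. The bimodule laws and compatibility equations
  stay open, since they are what center-symmetry of the product will be equivalent to.\<close>

locale mutual_actions =
  fixes s :: "'k::field \<Rightarrow> 'v::ab_group_add \<Rightarrow> 'v" and A m
    and t :: "'k \<Rightarrow> 'w::ab_group_add \<Rightarrow> 'w" and B n lA rA lB rB
  assumes csa_A: "center_symmetric_algebra s A m"
    and csa_B: "center_symmetric_algebra t B n"
    and lA: "bilinear_between s A t B t B lA"
    and rA: "bilinear_between s A t B t B rA"
    and lB: "bilinear_between t B s A s A lB"
    and rB: "bilinear_between t B s A s A rB"
begin

sublocale vA: vector_space s
  using csa_A by (simp add: center_symmetric_algebra_def)

sublocale vB: vector_space t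
  using csa_B by (simp add: center_symmetric_algebra_def)

sublocale vp: vector_space_prod s t ..

lemma subspace_A: "vA.subspace A" and subspace_B: "vB.subspace B"
  and bilinear_m: "bilinear_between s A s A s A m"
  and bilinear_n: "bilinear_between t B t B t B n"
  and center_A: "x \<in> A \<Longrightarrow> y \<in> A \<Longrightarrow> z \<in> A \<Longrightarrow> assoc m x y z = assoc m z y x"
  and center_B: "a \<in> B \<Longrightarrow> b \<in> B \<Longrightarrow> c \<in> B \<Longrightarrow> assoc n a b c = assoc n c b a"
  using csa_A csa_B unfolding center_symmetric_algebra_def by blast+

lemmas carrier =
  vA.subspace_0[OF subspace_A] vA.subspace_add[OF subspace_A] vA.subspace_scale[OF subspace_A]
  vB.subspace_0[OF subspace_B] vB.subspace_add[OF subspace_B] vB.subspace_scale[OF subspace_B]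

lemmas action_simps =
  bilinear_betweenD[OF bilinear_m] bilinear_betweenD[OF bilinear_n]
  bilinear_betweenD[OF lA] bilinear_betweenD[OF rA]
  bilinear_betweenD[OF lB] bilinear_betweenD[OF rB]

abbreviation "bprod \<equiv> bicrossed_product m n lA rA lB rB"

lemma subspace_prod: "vp.p.subspace (A \<times> B)"
  unfolding vp.p.subspace_def
  by (auto simp: carrier vp.scale_def zero_prod_def)

lemma bilinear_prod:
  "bilinear_between vp.scale (A \<times> B) vp.scale (A \<times> B) vp.scale (A \<times> B) bprod"
  by (rule bilinear_betweenI)
    (auto simp: bicrossed_product_def vp.scale_def carrier action_simps
      vA.scale_right_distrib vB.scale_right_distrib algebra_simps)

text \<open>One clause for each of the eight homogeneous positions. Reversal exchanges the third
  with the fourth and the sixth with the seventh; it maps the fifth and the eighth to themselves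
  with the two like variables swapped. When two entries come from one algebra, the component in that
  algebra leads to a compatibility equation and the other component to a bimodule law.\<close>

lemma assoc_prod:
  shows "x \<in> A \<Longrightarrow> y \<in> A \<Longrightarrow> z \<in> A \<Longrightarrow> 
      assoc bprod (x, 0) (y, 0) (z, 0) = (assoc m x y z, 0)"
    and "a \<in> B \<Longrightarrow> b \<in> B \<Longrightarrow> c \<in> B \<Longrightarrow> 
      assoc bprod (0, a) (0, b) (0, c) = (0, assoc n a b c)"
    and "x \<in> A \<Longrightarrow> y \<in> A \<Longrightarrow> a \<in> B \<Longrightarrow> 
      assoc bprod (x, 0) (y, 0) (0, a) =
      (rB a (m x y) - m x (rB a y) - rB (lA y a) x, lA (m x y) a - lA x (lA y a))"
    and "x \<in> A \<Longrightarrow> y \<in> A \<Longrightarrow> a \<in> B \<Longrightarrow> 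
      assoc bprod (0, a) (y, 0) (x, 0) =
      (m (lB a y) x + lB (rA y a) x - lB a (m y x), rA x (rA y a) - rA (m y x) a)"
    and "x \<in> A \<Longrightarrow> y \<in> A \<Longrightarrow> a \<in> B \<Longrightarrow> 
      assoc bprod (x, 0) (0, a) (y, 0) =
      (m (rB a x) y + lB (lA x a) y - m x (lB a y) - rB (rA y a) x,
       rA y (lA x a) - lA x (rA y a))"
    and "x \<in> A \<Longrightarrow> a \<in> B \<Longrightarrow> b \<in> B \<Longrightarrow> 
      assoc bprod (0, a) (0, b) (x, 0) =
      (lB (n a b) x - lB a (lB b x), rA x (n a b) - n a (rA x b) - rA (lB b x) a)"
    and "x \<in> A \<Longrightarrow> a \<in> B \<Longrightarrow> b \<in> B \<Longrightarrow> 
      assoc bprod (x, 0) (0, b) (0, a) =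
      (rB a (rB b x) - rB (n b a) x, n (lA x b) a + lA (rB b x) a - lA x (n b a))"
    and "x \<in> A \<Longrightarrow> a \<in> B \<Longrightarrow> b \<in> B \<Longrightarrow> 
      assoc bprod (0, a) (x, 0) (0, b) =
      (rB b (lB a x) - lB a (rB b x),
       n (rA x a) b + lA (lB a x) b - n a (lA x b) - rA (rB b x) a)"
  by (simp_all add: assoc_def bicrossed_product_def carrier action_simps algebra_simps)

text \<open>Triples whose lone element stands at an end correspond to the law for \<open>l\<close>
  of a product and to the first two compatibility equations. Those with the lone element in the
  middle correspond to the commutator law and to the last two.\<close>

lemma matched_pair_iff_center_symmetric:
  "matched_pair s A m t B n lA rA lB rB \<longleftrightarrow>
   center_symmetric_algebra vp.scale (A \<times> B) bprod"
proof
  assume mp: "matched_pair s A m t B n lA rA lB rB"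
  let ?S = "A \<times> {0} \<union> {0} \<times> B"
  have bimodules: "bimodule s A m t B lA rA" "bimodule t B n s A lB rB"
    using mp unfolding matched_pair_def by blast+
  have outer_A: "assoc bprod (x, 0) (y, 0) (0, a) = assoc bprod (0, a) (y, 0) (x, 0)"
    if that: "x \<in> A" "y \<in> A" "a \<in> B" for x y a
  proof -
    have "- rB a (m x y) + rB (lA y a) x + m x (rB a y)
      + lB (rA y a) x + m (lB a y) x - lB a (m y x) = 0"
      using mp that unfolding matched_pair_def by blast
    moreover have "lA (m x y) a - lA x (lA y a) = rA x (rA y a) - rA (m y x) a"
      using bimodules that unfolding bimodule_def by blast
    ultimately show ?thesis
      by (simp add: assoc_prod that carrier) (simp add: algebra_simps)
  qed
  \<comment> \<open>With the element of \<open>B\<close> in the middle, reversal only exchanges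
    \<open>x\<close> and \<open>y\<close>; this is why the commutator law, symmetric in the same
    way, appears.\<close>
  have inner_B: "assoc bprod (x, 0) (0, a) (y, 0) = assoc bprod (y, 0) (0, a) (x, 0)"
    if that: "x \<in> A" "y \<in> A" "a \<in> B" for x y a
  proof -
    have "m x (lB a y) + m (rB a y) x - m (rB a x) y - lB (lA x a) y
      + rB (rA y a) x + lB (lA y a) x - m y (lB a x) - rB (rA x a) y = 0"
      using mp that unfolding matched_pair_def by blast
    moreover have "lA x (rA y a) - rA y (lA x a) = lA y (rA x a) - rA x (lA y a)"
      using bimodules that unfolding bimodule_def by blast
    ultimately show ?thesis
      by (simp add: assoc_prod that carrier) (simp add: algebra_simps)
  qed
  have outer_B: "assoc bprod (0, a) (0, b) (x, 0) = assoc bprod (x, 0) (0, b) (0, a)"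
    if that: "x \<in> A" "a \<in> B" "b \<in> B" for x a b
  proof -
    have "- rA x (n a b) + rA (lB b x) a + n a (rA x b)
      + lA (rB b x) a + n (lA x b) a - lA x (n b a) = 0"
      using mp that unfolding matched_pair_def by blast
    moreover have "lB (n a b) x - lB a (lB b x) = rB a (rB b x) - rB (n b a) x"
      using bimodules that unfolding bimodule_def by blast
    ultimately show ?thesis
      by (simp add: assoc_prod that carrier) (simp add: algebra_simps)
  qed
  have inner_A: "assoc bprod (0, a) (x, 0) (0, b) = assoc bprod (0, b) (x, 0) (0, a)"
    if that: "x \<in> A" "a \<in> B" "b \<in> B" for x a b
  proof -
    have "n a (lA x b) + n (rA x b) a - n (rA x a) b - lA (lB a x) b
      + rA (rB b x) a + lA (lB b x) a - n b (lA x a) - rA (rB a x) b = 0"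
      using mp that unfolding matched_pair_def by blast
    moreover have "lB a (rB b x) - rB b (lB a x) = lB b (rB a x) - rB a (lB b x)"
      using bimodules that unfolding bimodule_def by blast
    ultimately show ?thesis
      by (simp add: assoc_prod that carrier) (simp add: algebra_simps)
  qed
  \<comment> \<open>The two unmixed cases are center-symmetry of \<open>A\<close> and of
    \<open>B\<close>. The six mixed ones are the four facts above, the outer ones read in both
    directions.\<close>
  have pure: "assoc bprod x y z = assoc bprod z y x"
    if "x \<in> ?S" "y \<in> ?S" "z \<in> ?S" for x y z
    using that outer_A outer_B inner_A inner_B
    by (auto simp: assoc_prod(1,2) center_A center_B carrier)
  have "assoc bprod x y z = assoc bprod z y x"
    if "x \<in> A \<times> B" "y \<in> A \<times> B" "z \<in> A \<times> B" for x y z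
  proof (rule assoc_symmetric_on_sum[OF bilinear_prod _ pure _ that])
    show "?S \<subseteq> A \<times> B" by (auto simp: carrier)
    show "\<exists>p\<in>?S. \<exists>q\<in>?S. x = p + q" if "x \<in> A \<times> B" for x
      using that by (intro bexI[of _ "(fst x, 0)"] bexI[of _ "(0, snd x)"]) auto
  qed
  then show "center_symmetric_algebra vp.scale (A \<times> B) bprod"
    unfolding center_symmetric_algebra_def
    using vp.p.vector_space_axioms subspace_prod bilinear_prod by blast
next
  assume csa: "center_symmetric_algebra vp.scale (A \<times> B) bprod"
  have sym: "assoc bprod p q r = assoc bprod r q p"
    if "p \<in> A \<times> B" "q \<in> A \<times> B" "r \<in> A \<times> B" for p q r
    using csa that unfolding center_symmetric_algebra_def by blast
  \<comment> \<open>An equation between pairs splits into components, so each kind of mixed triple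
    returns one bimodule law and one compatibility equation.\<close>
  have outer_A: "lA (m x y) a - lA x (lA y a) = rA x (rA y a) - rA (m y x) a"
    "- rB a (m x y) + rB (lA y a) x + m x (rB a y)
      + lB (rA y a) x + m (lB a y) x - lB a (m y x) = 0"
    if "x \<in> A" "y \<in> A" "a \<in> B" for x y a
    using sym[of "(x, 0)" "(y, 0)" "(0, a)"] that
    by (simp_all add: assoc_prod carrier) (simp_all add: algebra_simps)
  have inner_B: "lA x (rA y a) - rA y (lA x a) = lA y (rA x a) - rA x (lA y a)"
    "m x (lB a y) + m (rB a y) x - m (rB a x) y - lB (lA x a) y
      + rB (rA y a) x + lB (lA y a) x - m y (lB a x) - rB (rA x a) y = 0"
    if "x \<in> A" "y \<in> A" "a \<in> B" for x y a
    using sym[of "(x, 0)" "(0, a)" "(y, 0)"] that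
    by (simp_all add: assoc_prod carrier) (simp_all add: algebra_simps)
  have outer_B: "lB (n a b) x - lB a (lB b x) = rB a (rB b x) - rB (n b a) x"
    "- rA x (n a b) + rA (lB b x) a + n a (rA x b)
      + lA (rB b x) a + n (lA x b) a - lA x (n b a) = 0"
    if "x \<in> A" "a \<in> B" "b \<in> B" for x a b
    using sym[of "(0, a)" "(0, b)" "(x, 0)"] that
    by (simp_all add: assoc_prod carrier) (simp_all add: algebra_simps)
  have inner_A: "lB a (rB b x) - rB b (lB a x) = lB b (rB a x) - rB a (lB b x)"
    "n a (lA x b) + n (rA x b) a - n (rA x a) b - lA (lB a x) b
      + rA (rB b x) a + lA (lB b x) a - n b (lA x a) - rA (rB a x) b = 0"
    if "x \<in> A" "a \<in> B" "b \<in> B" for x a b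
    using sym[of "(0, a)" "(x, 0)" "(0, b)"] that
    by (simp_all add: assoc_prod carrier) (simp_all add: algebra_simps)
  have "bimodule s A m t B lA rA"
    unfolding bimodule_def
    using vB.vector_space_axioms subspace_B lA rA inner_B(1) outer_A(1) by blast
  moreover have "bimodule t B n s A lB rB"
    unfolding bimodule_def
    using vA.vector_space_axioms subspace_A lB rB inner_A(1) outer_B(1) by blast
  ultimately show "matched_pair s A m t B n lA rA lB rB"
    unfolding matched_pair_def
    using csa_A csa_B inner_A(2) inner_B(2) outer_A(2) outer_B(2) by blast
qed

end

section \<open>Transposed actions on the dual and the standard form\<close>

lemma dual_map_bilinear:
  assumes "vector_space s" "bilinear_between s UNIV s UNIV s UNIV G"
  shows "bilinear_between s UNIV dual_scale (dual s) dual_scale (dual s) (\<lambda>x. dual_map (G x))"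
  by (rule bilinear_betweenI)
    (auto simp: in_dual_iff[OF assms(1)] dual_map_def dual_scale_def bilinear_betweenD[OF assms(2)])

lemma dual_scale_apply: "dual_scale c f v = c * f v"
  by (simp add: dual_scale_def)

section \<open>Pairing a finite-dimensional space with its dual\<close>

context finite_dimensional_vector_space
begin

lemma in_dual: "f \<in> dual scale \<longleftrightarrow> (\<forall>x y. f (x + y) = f x + f y) \<and> (\<forall>c x. f (scale c x) = c * f x)"
  by (rule in_dual_iff) unfold_locales

text \<open>For the identity on the dual, \<open>bidual_dual_map_ex1\<close> says that the vector
  representing evaluation at \<open>y\<close> is unique; both \<open>x\<close> and \<open>y\<close>
  represent it.\<close>

lemma dual_separates:
  assumes "\<And>b. b \<in> dual scale \<Longrightarrow> b x = b y"
  shows "x = y"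
proof -
  have "\<exists>!z. \<forall>b\<in>dual scale. b z = b y"
    using bidual_dual_map_ex1[of scale Basis "\<lambda>b. b" y] finite_dimensional_vector_space_axioms
    by (auto simp: linear_between_def)
  then show ?thesis using assms by blast
qed

text \<open>The adjunction between \<open>g\<close> and its transpose, through which the definite
  description is handled from here on.\<close>

lemma bidual_dual_map_eval:
  assumes "linear_between dual_scale (dual scale) dual_scale (dual scale) g" "b \<in> dual scale"
  shows "b (bidual_dual_map scale g x) = g b x"
  using theI'[OF bidual_dual_map_ex1[OF finite_dimensional_vector_space_axioms assms(1)], of x]
    assms(2) unfolding bidual_dual_map_def by blast

lemma bidual_dual_map_bilinear:
  assumes "bilinear_between dual_scale (dual scale) dual_scale (dual scale) dual_scale (dual scale) G"
  shows "bilinear_between dual_scale (dual scale) scale UNIV scale UNIV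
    (\<lambda>a. bidual_dual_map scale (G a))"
proof -
  have vs: "vector_space scale" by unfold_locales
  interpret d: vector_space "dual_scale :: 'a \<Rightarrow> ('b \<Rightarrow> 'a) \<Rightarrow> _"
    by (rule vector_space_dual_scale)
  have eval: "b (bidual_dual_map scale (G a) x) = G a b x"
    if "a \<in> dual scale" "b \<in> dual scale" for a b x
    using assms that by (intro bidual_dual_map_eval) (auto simp: bilinear_between_def)
  have closed: "a + b \<in> dual scale" "dual_scale c a \<in> dual scale"
    if "a \<in> dual scale" "b \<in> dual scale" for a b c
    using d.subspace_add d.subspace_scale subspace_dual[OF vs] that by blast+
  note G = bilinear_betweenD[OF assms]
  have lin: "b (x + y) = b x + b y" "b (scale c x) = c * b x" if "b \<in> dual scale" for b c x y
    using that by (simp_all add: in_dual)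
  show ?thesis
    \<comment> \<open>Each equation between vectors is tested against functionals, where
      \<open>eval\<close> turns it into an equation for \<open>G\<close>. The closure goal is no
      equation and is left as it is.\<close>
    by (rule bilinear_betweenI; (rule dual_separates)?)
      (simp_all add: lin eval closed G dual_scale_apply)
qed

end

section \<open>The algebra, its dual and their mutual transposed actions\<close>

context
  fixes scale :: "'k::field \<Rightarrow> 'a::ab_group_add \<Rightarrow> 'a"
    and Basis :: "'a set"
    and dot :: "'a \<Rightarrow> 'a \<Rightarrow> 'a"
    and circ :: "('a \<Rightarrow> 'k) \<Rightarrow> ('a \<Rightarrow> 'k) \<Rightarrow> ('a \<Rightarrow> 'k)"
  assumes fin: "finite_dimensional_vector_space scale Basis"
    and csa_dot: "center_symmetric_algebra scale UNIV dot"
    and csa_circ: "center_symmetric_algebra dual_scale (dual scale) circ"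
begin

interpretation finite_dimensional_vector_space scale Basis by (fact fin)

lemma bilinear_dot: "bilinear_between scale UNIV scale UNIV scale UNIV dot"
  and bilinear_circ: "bilinear_between dual_scale (dual scale) dual_scale (dual scale)
    dual_scale (dual scale) circ"
  using csa_dot csa_circ unfolding center_symmetric_algebra_def by blast+

lemma bilinear_mult:
  "bilinear_between scale UNIV scale UNIV scale UNIV (Lmult dot)"
  "bilinear_between scale UNIV scale UNIV scale UNIV (Rmult dot)"
  "bilinear_between dual_scale (dual scale) dual_scale (dual scale)
    dual_scale (dual scale) (Lmult circ)"
  "bilinear_between dual_scale (dual scale) dual_scale (dual scale)
    dual_scale (dual scale) (Rmult circ)"
  using bilinear_dot bilinear_circ
  unfolding bilinear_between_def Lmult_def[abs_def] Rmult_def[abs_def] by blast+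

text \<open>The exchange of left and right is dictated by invariance of the form: pairing
  \<open>y\<close> with \<open>x * b\<close> must equal pairing \<open>y * x\<close> with
  \<open>b\<close>, so \<open>x\<close> acts on the dual from the left by the transpose of its right
  multiplication.\<close>

interpretation mutual_actions scale UNIV dot dual_scale "dual scale" circ
  "\<lambda>x. dual_map (Rmult dot x)" "\<lambda>x. dual_map (Lmult dot x)"
  "\<lambda>a. bidual_dual_map scale (Rmult circ a)" "\<lambda>a. bidual_dual_map scale (Lmult circ a)"
  using csa_dot csa_circ vector_space_axioms
  by unfold_locales (auto intro!: dual_map_bilinear bidual_dual_map_bilinear bilinear_mult)

lemma bidual_eval:
  assumes "a \<in> dual scale" "b \<in> dual scale"
  shows "b (bidual_dual_map scale (Rmult circ a) x) = circ b a x"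
    and "b (bidual_dual_map scale (Lmult circ a) x) = circ a b x"
  using bidual_dual_map_eval[of "Rmult circ a" b x] bidual_dual_map_eval[of "Lmult circ a" b x]
    bilinear_mult(3,4) assms
  by (auto simp: bilinear_between_def Lmult_def Rmult_def)

lemma dual_add: "f \<in> dual scale \<Longrightarrow> f (x + y) = f x + f y"
  and dual_scaled: "f \<in> dual scale \<Longrightarrow> f (scale c x) = c * f x"
  and dual_zero: "f \<in> dual scale \<Longrightarrow> f 0 = 0"
  by (simp_all add: in_dual) (metis add_cancel_right_right add_0)

lemma zero_in_dual: "0 \<in> dual scale"
  by (simp add: in_dual)

section \<open>The standard form and its invariance\<close>

lemma standard_form_bilinear:
  "bilinear_between vp.scale (UNIV \<times> dual scale) vp.scale (UNIV \<times> dual scale) (*) UNIV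
    standard_form"
  by (rule bilinear_betweenI)
    (auto simp: standard_form_def vp.scale_def dual_add dual_scaled dual_scale_def algebra_simps)

text \<open>Testing against \<open>(0, b)\<close> isolates \<open>b (fst x)\<close>, and functionals
  separate vectors; testing against \<open>(y, 0)\<close> isolates the value of \<open>snd x\<close>
  at \<open>y\<close>.\<close>

lemma standard_form_nondegenerate:
  assumes "x \<in> UNIV \<times> dual scale" and "\<And>y. y \<in> UNIV \<times> dual scale \<Longrightarrow> standard_form x y = 0"
  shows "x = 0"
proof -
  have "fst x = 0"
    by (rule dual_separates) (use assms(2)[of "(0, _)"] assms(1) in
      \<open>auto simp: standard_form_def dual_zero\<close>)
  moreover have "snd x = 0"
    by (rule ext) (use assms(2)[of "(_, 0)"] zero_in_dual in \<open>auto simp: standard_form_def\<close>)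
  ultimately show ?thesis by (simp add: prod_eq_iff)
qed

text \<open>For \<open>p = (x, a)\<close>, \<open>q = (y, b)\<close>, \<open>r = (z, c)\<close> both
  sides equal the cyclically symmetric sum \<open>c (dot x y) + a (dot y z) + b (dot z x) + circ b c
  x + circ c a y + circ a b z\<close>.\<close>

lemma standard_form_invariant:
  assumes "p \<in> UNIV \<times> dual scale" "q \<in> UNIV \<times> dual scale" "r \<in> UNIV \<times> dual scale"
  shows "standard_form (bprod p q) r = standard_form p (bprod q r)"
  using assms
  by (auto simp: standard_form_def bicrossed_product_def bidual_eval dual_add
      dual_map_def Lmult_def Rmult_def)

text \<open>Center-symmetry is the only condition at stake: the decomposition, the subalgebras and
  the properties of the form come from the construction of \<open>bprod\<close>.\<close>

lemma manin_triple_bprod: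
  assumes "center_symmetric_algebra vp.scale (UNIV \<times> dual scale) bprod"
  shows "manin_triple vp.scale (UNIV \<times> dual scale) (UNIV \<times> {0}) ({0} \<times> dual scale)
    bprod standard_form"
proof -
  have "direct_sum (UNIV \<times> dual scale) (UNIV \<times> {0}) ({0} \<times> dual scale)"
    unfolding direct_sum_def using zero_in_dual by (auto simp: zero_prod_def)
  moreover have "subalgebra vp.scale (UNIV \<times> dual scale) bprod (UNIV \<times> {0})"
    "subalgebra vp.scale (UNIV \<times> dual scale) bprod ({0} \<times> dual scale)"
    using zero_in_dual unfolding subalgebra_def vp.p.subspace_def
    by (auto simp: vp.scale_def zero_prod_def bicrossed_product_def carrier action_simps)
  ultimately show ?thesis
    unfolding manin_triple_def
    using assms standard_form_bilinear standard_form_nondegenerate standard_form_invariant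
    by (auto simp: standard_form_def dual_zero add.commute)
qed

text \<open>A mixed product is determined by its pairings with both summands. Invariance and
  symmetry of the form move the factors until the only product left lies inside one summand, where
  \<open>p\<close> is prescribed. Since \<open>bprod\<close> is invariant as well and has the same
  restrictions, it yields the same values.\<close>

lemma invariant_product_unique:
  assumes p_dot: "\<And>x y. p (x, 0) (y, 0) = (dot x y, 0)"
    and p_circ: "\<And>a b. a \<in> dual scale \<Longrightarrow> b \<in> dual scale \<Longrightarrow> p (0, a) (0, b) = (0, circ a b)"
    and bil: "bilinear_between vp.scale (UNIV \<times> dual scale) vp.scale (UNIV \<times> dual scale)
      vp.scale (UNIV \<times> dual scale) p"
    and inv: "\<And>u v w. u \<in> UNIV \<times> dual scale \<Longrightarrow> v \<in> UNIV \<times> dual scale \<Longrightarrow>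
      w \<in> UNIV \<times> dual scale \<Longrightarrow> standard_form (p u v) w = standard_form u (p v w)"
    and u: "u \<in> UNIV \<times> dual scale" and v: "v \<in> UNIV \<times> dual scale"
  shows "p u v = bprod u v"
proof -
  have sym: "standard_form w z = standard_form z w" for w z :: "'a \<times> ('a \<Rightarrow> 'k)"
    by (simp add: standard_form_def add.commute)
  have agree: "w = z" if "w \<in> UNIV \<times> dual scale" "z \<in> UNIV \<times> dual scale"
    "\<And>y. standard_form w (y, 0) = standard_form z (y, 0)"
    "\<And>c. c \<in> dual scale \<Longrightarrow> standard_form w (0, c) = standard_form z (0, c)" for w z
  proof -
    have "fst w = fst z"
      by (rule dual_separates) (use that in \<open>auto simp: standard_form_def dual_zero\<close>)
    moreover have "snd w = snd z"
      by (rule ext) (use that in \<open>auto simp: standard_form_def dual_zero\<close>)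
    ultimately show ?thesis by (simp add: prod_eq_iff)
  qed
  note in_C = bilinear_betweenD(1)[OF bil] bilinear_betweenD(1)[OF bilinear_prod]
  have b_dot: "bprod (x, 0) (y, 0) = (dot x y, 0)" for x y
    by (simp add: bicrossed_product_def action_simps carrier)
  have b_circ: "bprod (0, a) (0, b) = (0, circ a b)" if "a \<in> dual scale" "b \<in> dual scale" for a b
    using that by (simp add: bicrossed_product_def action_simps carrier)
  have mixed1: "p (x, 0) (0, b) = bprod (x, 0) (0, b)" if "b \<in> dual scale" for x b
  proof (rule agree)
    \<comment> \<open>Invariance for \<open>(y, 0)\<close>, \<open>(x, 0)\<close>,
      \<open>(0, b)\<close> trades the mixed product for \<open>dot y x\<close>. It leaves the mixed
      product in the second argument of the form, so symmetry is applied first.\<close>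
    show "standard_form (p (x, 0) (0, b)) (y, 0) = standard_form (bprod (x, 0) (0, b)) (y, 0)" for y
      using inv[of "(y, 0)" "(x, 0)" "(0, b)"] standard_form_invariant[of "(y, 0)" "(x, 0)" "(0, b)"]
        that zero_in_dual by (simp add: p_dot b_dot sym[of _ "(y, 0)"])
    show "standard_form (p (x, 0) (0, b)) (0, c) = standard_form (bprod (x, 0) (0, b)) (0, c)"
      if "c \<in> dual scale" for c
      using inv[of "(x, 0)" "(0, b)" "(0, c)"] standard_form_invariant[of "(x, 0)" "(0, b)" "(0, c)"]
        that \<open>b \<in> dual scale\<close> zero_in_dual by (simp add: p_circ b_circ)
  qed (use that zero_in_dual in \<open>auto intro!: in_C\<close>)
  have mixed2: "p (0, a) (y, 0) = bprod (0, a) (y, 0)" if "a \<in> dual scale" for y a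
  proof (rule agree)
    show "standard_form (p (0, a) (y, 0)) (z, 0) = standard_form (bprod (0, a) (y, 0)) (z, 0)" for z
      using inv[of "(0, a)" "(y, 0)" "(z, 0)"] standard_form_invariant[of "(0, a)" "(y, 0)" "(z, 0)"]
        that zero_in_dual by (simp add: p_dot b_dot)
    show "standard_form (p (0, a) (y, 0)) (0, c) = standard_form (bprod (0, a) (y, 0)) (0, c)"
      if "c \<in> dual scale" for c
      \<comment> \<open>The same rotation on the dual side: the pure product is now
        \<open>circ c a\<close>.\<close>
      using inv[of "(0, c)" "(0, a)" "(y, 0)"] standard_form_invariant[of "(0, c)" "(0, a)" "(y, 0)"]
        that \<open>a \<in> dual scale\<close> zero_in_dual by (simp add: p_circ b_circ sym[of _ "(0, c)"])
  qed (use that zero_in_dual in \<open>auto intro!: in_C\<close>)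
  obtain x a y b where uv: "u = (x, 0) + (0, a)" "v = (y, 0) + (0, b)"
    and ab: "a \<in> dual scale" "b \<in> dual scale"
    using u v by (auto simp: mem_Times_iff) (metis prod.collapse)
  have C: "(x, 0) \<in> UNIV \<times> dual scale" "(0, a) \<in> UNIV \<times> dual scale"
    "(y, 0) \<in> UNIV \<times> dual scale" "(0, b) \<in> UNIV \<times> dual scale"
    using ab zero_in_dual by auto
  \<comment> \<open>Stated for an arbitrary bilinear \<open>f\<close> so that it serves both
    \<open>p\<close> and \<open>bprod\<close>.\<close>
  have expand: "f u v = f (x, 0) (y, 0) + f (x, 0) (0, b) + (f (0, a) (y, 0) + f (0, a) (0, b))"
    if "bilinear_between vp.scale (UNIV \<times> dual scale) vp.scale (UNIV \<times> dual scale)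
      vp.scale (UNIV \<times> dual scale) f" for f
    using bilinear_betweenD(2)[OF that C(1) C(2) v] bilinear_betweenD(3)[OF that C(1) C(3) C(4)]
      bilinear_betweenD(3)[OF that C(2) C(3) C(4)] by (simp only: uv)
  show ?thesis
    unfolding expand[OF bil] expand[OF bilinear_prod]
    using ab by (simp only: p_dot b_dot p_circ b_circ mixed1 mixed2)
qed

text \<open>The product \<open>bprod\<close> is a witness once it is center-symmetric; conversely
  any witness coincides with \<open>bprod\<close> on the carrier by
  \<open>invariant_product_unique\<close>, so its center-symmetry carries over.\<close>

lemma standard_manin_triple_iff:
  "standard_manin_triple scale dot circ \<longleftrightarrow>
   center_symmetric_algebra vp.scale (UNIV \<times> dual scale) bprod"
proof
  assume "center_symmetric_algebra vp.scale (UNIV \<times> dual scale) bprod"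
  then show "standard_manin_triple scale dot circ"
    unfolding standard_manin_triple_def
    using manin_triple_bprod
    by (intro exI[of _ bprod])
      (simp add: bicrossed_product_def action_simps carrier)
next
  assume "standard_manin_triple scale dot circ"
  then obtain p where p: "\<And>x y. p (x, 0) (y, 0) = (dot x y, 0)"
      "\<And>a b. a \<in> dual scale \<Longrightarrow> b \<in> dual scale \<Longrightarrow> p (0, a) (0, b) = (0, circ a b)"
    and manin: "manin_triple vp.scale (UNIV \<times> dual scale) (UNIV \<times> {0}) ({0} \<times> dual scale)
      p standard_form"
    unfolding standard_manin_triple_def by blast
  have csa: "center_symmetric_algebra vp.scale (UNIV \<times> dual scale) p"
    using manin unfolding manin_triple_def by blast
  then have bil: "bilinear_between vp.scale (UNIV \<times> dual scale) vp.scale (UNIV \<times> dual scale)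
      vp.scale (UNIV \<times> dual scale) p"
    unfolding center_symmetric_algebra_def by blast
  have eq: "bprod u v = p u v" if "u \<in> UNIV \<times> dual scale" "v \<in> UNIV \<times> dual scale" for u v
    by (rule invariant_product_unique[OF p bil _ that, symmetric])
      (use manin in \<open>unfold manin_triple_def, blast+\<close>)
  \<comment> \<open>Agreement of the two products is known on the carrier only, so closure under
    \<open>p\<close> is used to rewrite the outer products.\<close>
  have "assoc bprod u v w = assoc p u v w" if "u \<in> UNIV \<times> dual scale"
    "v \<in> UNIV \<times> dual scale" "w \<in> UNIV \<times> dual scale" for u v w
    unfolding assoc_def using that by (simp only: eq bilinear_betweenD(1)[OF bil])
  then show "center_symmetric_algebra vp.scale (UNIV \<times> dual scale) bprod"
    using csa bilinear_prod unfolding center_symmetric_algebra_def by metis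
qed

text \<open>Both notions amount to center-symmetry of \<open>bprod\<close>, which folding eliminates
  as the middle term.\<close>

lemmas matched_pair_iff_standard_manin_triple =
  matched_pair_iff_center_symmetric[folded standard_manin_triple_iff]

end

theorem theorem4p2:
  fixes scale :: "'k::field_char_0 \<Rightarrow> 'a::ab_group_add \<Rightarrow> 'a"
    and Basis :: "'a set"
    and dot :: "'a \<Rightarrow> 'a \<Rightarrow> 'a"
    and circ :: "('a \<Rightarrow> 'k) \<Rightarrow> ('a \<Rightarrow> 'k) \<Rightarrow> ('a \<Rightarrow> 'k)"
  assumes "finite_dimensional_vector_space scale Basis"
    and "center_symmetric_algebra scale UNIV dot"
    and "center_symmetric_algebra dual_scale (dual scale) circ"
  shows "matched_pair scale UNIV dot dual_scale (dual scale) circ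
           (\<lambda>x. dual_map (Rmult dot x)) (\<lambda>x. dual_map (Lmult dot x))
           (\<lambda>a. bidual_dual_map scale (Rmult circ a)) (\<lambda>a. bidual_dual_map scale (Lmult circ a))
         \<longleftrightarrow> standard_manin_triple scale dot circ"
  using assms by (rule matched_pair_iff_standard_manin_triple)

end
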